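(* Let $\gamma,L>0$ and $\varepsilon\ge 0$. Suppose that: for every $w\in M$, $\phi(\cdot,\cdot,w)$ is continuously differentiable on $\mathbb{R}^n\times\mathbb{R}^m$, $\gamma$-strongly convex in $x$ for every $y\in\mathbb{R}^m$ and $\gamma$-strongly concave in $y$ for every $x\in\mathbb{R}^n$; the map $\psi(z,w)=(\nabla_x\phi(z,w),-\nabla_y\phi(z,w))$ satisfies $\|\psi(z,w)-\psi(z',w)\|\le L\|z-z'\|$ and $\|\psi(z,w)-\psi(z,w')\|\le L\,\mathrm{d}(w,w')$ for all $z,z'\in\mathbb{R}^n\times\mathbb{R}^m$ and $w,w'\in M$; $W_1(D(z),D(z'))\le\varepsilon\|z-z'\|$ for all $z,z'\in\mathbb{R}^n\times\mathbb{R}^m$; and $\mathcal{X}\subset\mathbb{R}^n$, $\mathcal{Y}\subset\mathbb{R}^m$ are compact and convex. Then: 1. for all $z,z'\in\mathcal{Z}=\mathcal{X}\times\mathcal{Y}$, $\|H(z)-H(z')\|\le\frac{\varepsilon L}{\gamma}\|z-z'\|$; 2. if $\frac{\varepsilon L}{\gamma}<1$, then there exists a unique equilibrium point $(\bar x,\bar y)\in\mathcal{X}\times\mathcal{Y}$.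
   Context: $(M,\mathrm{d})$ is a complete separable metric space, $\mathcal{P}(M)$ is the set of Radon probability measures on $M$ with finite first moment, and $W_1$ is the Wasserstein-1 distance. $\phi:\mathbb{R}^n\times\mathbb{R}^m\times M\to\mathbb{R}$, and $D:\mathbb{R}^n\times\mathbb{R}^m\to\mathcal{P}(M)$ is the distributional map. Write $z=(x,y)$; $\|\cdot\|$ is the Euclidean norm. The decoupled objective is $\Phi(x',y';x,y)=\mathbb{E}_{w\sim D(x,y)}[\phi(x',y',w)]$, and $$H(x,y)=\Big(\arg\min_{x'\in\mathcal{X}}\max_{y'\in\mathcal{Y}}\Phi(x',y';x,y),\ \arg\max_{y'\in\mathcal{Y}}\min_{x'\in\mathcal{X}}\Phi(x',y';x,y)\Big),$$ which under the hypotheses is single-valued and is identified with a map $\mathcal{Z}\to\mathcal{Z}$. An equilibrium point is a point $\bar z\in\mathcal{Z}$ with $\bar z\in H(\bar z)$. Constraint sets are nonempty and expectations are assumed well defined. *)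

theory Defs
  imports "HOL-Probability.Probability"
begin

definition continuously_differentiable ::
    "('a::real_normed_vector \<Rightarrow> 'b::real_normed_vector) \<Rightarrow> bool" where
  "continuously_differentiable f \<longleftrightarrow>
     (\<exists>f'. (\<forall>x. (f has_derivative blinfun_apply (f' x)) (at x)) \<and> continuous_on UNIV f')"

definition grad :: "('a::real_inner \<Rightarrow> real) \<Rightarrow> 'a \<Rightarrow> 'a" where
  "grad f x = (THE D. GDERIV f x :> D)"

definition strongly_convex_on :: "real \<Rightarrow> 'a::real_inner set \<Rightarrow> ('a \<Rightarrow> real) \<Rightarrow> bool" where
  "strongly_convex_on \<gamma> S f \<longleftrightarrow> convex S \<and>
     (\<forall>x\<in>S. \<forall>y\<in>S. \<forall>t\<in>{0..1}.
        f ((1 - t) *\<^sub>R x + t *\<^sub>R y)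
          \<le> (1 - t) * f x + t * f y - \<gamma> / 2 * t * (1 - t) * (norm (x - y))\<^sup>2)"

definition strongly_concave_on :: "real \<Rightarrow> 'a::real_inner set \<Rightarrow> ('a \<Rightarrow> real) \<Rightarrow> bool" where
  "strongly_concave_on \<gamma> S f \<longleftrightarrow> strongly_convex_on \<gamma> S (\<lambda>x. - f x)"

text \<open>Local finiteness, the other half of the Radon property, is automatic for the
  probability measures considered below.\<close>

definition inner_regular_compact :: "'a::topological_space measure \<Rightarrow> bool" where
  "inner_regular_compact \<mu> \<longleftrightarrow>
     (\<forall>B\<in>sets borel. emeasure \<mu> B = (SUP K\<in>{K. K \<subseteq> B \<and> compact K}. emeasure \<mu> K))"

text \<open>The Radon probability measures with finite first moment. By the triangle inequality,
  finiteness of the first moment does not depend on the base point.\<close>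

definition prob_measures1 :: "'a::metric_space measure set" where
  "prob_measures1 = {\<mu>. prob_space \<mu> \<and> sets \<mu> = sets borel \<and> inner_regular_compact \<mu> \<and>
     (\<exists>w0. integrable \<mu> (\<lambda>w. dist w0 w))}"

text \<open>On a second countable space the Borel sets of the product are the product of the Borel
  sigma-algebras, so that these are the usual couplings.\<close>

definition couplings :: "'a::polish_space measure \<Rightarrow> 'a measure \<Rightarrow> ('a \<times> 'a) measure set" where
  "couplings \<mu> \<nu> =
     {\<pi>. prob_space \<pi> \<and> sets \<pi> = sets borel \<and> distr \<pi> borel fst = \<mu> \<and> distr \<pi> borel snd = \<nu>}"

definition wasserstein1 :: "'a::polish_space measure \<Rightarrow> 'a measure \<Rightarrow> ennreal" where
  "wasserstein1 \<mu> \<nu> = (INF \<pi>\<in>couplings \<mu> \<nu>. \<integral>\<^sup>+ p. ennreal (dist (fst p) (snd p)) \<partial>\<pi>)"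

definition saddle_grad ::
    "('a::real_inner \<Rightarrow> 'b::real_inner \<Rightarrow> 'w \<Rightarrow> real) \<Rightarrow> 'a \<times> 'b \<Rightarrow> 'w \<Rightarrow> 'a \<times> 'b" where
  "saddle_grad \<phi> z w =
     (grad (\<lambda>x. \<phi> x (snd z) w) (fst z), - grad (\<lambda>y. \<phi> (fst z) y w) (snd z))"

definition decoupled ::
    "('a \<Rightarrow> 'b \<Rightarrow> 'w \<Rightarrow> real) \<Rightarrow> ('a \<times> 'b \<Rightarrow> 'w measure) \<Rightarrow> 'a \<Rightarrow> 'b \<Rightarrow> 'a \<times> 'b \<Rightarrow> real" where
  "decoupled \<phi> D x' y' z = (\<integral>w. \<phi> x' y' w \<partial>D z)"

text \<open>The solution map, set-valued. The inner maximum and minimum are written as supremum and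
  infimum in the reals, which is the same whenever they are attained.\<close>

definition solution_map ::
    "'a set \<Rightarrow> 'b set \<Rightarrow> ('a \<Rightarrow> 'b \<Rightarrow> 'w \<Rightarrow> real) \<Rightarrow> ('a \<times> 'b \<Rightarrow> 'w measure)
       \<Rightarrow> 'a \<times> 'b \<Rightarrow> ('a \<times> 'b) set" where
  "solution_map X Y \<phi> D z =
     {x. is_arg_min (\<lambda>x'. SUP y'\<in>Y. decoupled \<phi> D x' y' z) (\<lambda>x'. x' \<in> X) x} \<times>
     {y. is_arg_max (\<lambda>y'. INF x'\<in>X. decoupled \<phi> D x' y' z) (\<lambda>y'. y' \<in> Y) y}"

definition equilibrium_point ::
    "'a set \<Rightarrow> 'b set \<Rightarrow> ('a \<Rightarrow> 'b \<Rightarrow> 'w \<Rightarrow> real) \<Rightarrow> ('a \<times> 'b \<Rightarrow> 'w measure)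
       \<Rightarrow> 'a \<times> 'b \<Rightarrow> bool" where
  "equilibrium_point X Y \<phi> D z \<longleftrightarrow> z \<in> X \<times> Y \<and> z \<in> solution_map X Y \<phi> D z"

end

theory Submission
  imports Defs
begin

text \<open>Fix a base point \<open>z\<close> and let \<open>G z u\<close> be the expectation of the saddle gradient at \<open>u\<close>
  under \<open>D z\<close>. The solution of the decoupled minimax problem at \<open>z\<close> is the point \<open>H z\<close> of
  \<open>X \<times> Y\<close> that solves the variational inequality
  \<open>G z (H z) \<bullet> (u - H z) \<ge> 0\<close> for all \<open>u \<in> X \<times> Y\<close>. Two variational inequalities with
  \<open>\<gamma>\<close>-strongly monotone operators have solutions at distance at most \<open>1 / \<gamma>\<close> times the gap
  between the operators (\<open>solves_VI_stable\<close>). The gap between \<open>G z\<close> and \<open>G z'\<close> at a fixed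
  point is a difference of two expectations of one and the same \<open>L\<close>-Lipschitz function of
  \<open>w\<close>, hence at most \<open>L\<close> times the Wasserstein distance of \<open>D z\<close> and \<open>D z'\<close>
  (\<open>integral_diff_le_wasserstein1\<close>), that is at most \<open>L \<epsilon> \<parallel>z - z'\<parallel>\<close>. This gives the
  Lipschitz constant \<open>\<epsilon> L / \<gamma>\<close>. Equilibrium points are the fixed points of \<open>H\<close>, so that the
  second claim is Banach's fixed point theorem on the compact set \<open>X \<times> Y\<close>.

  The link between \<open>G z\<close> and the minimax problem is made as follows. Strong
  convexity and concavity are rewritten as first-order inequalities for each \<open>w\<close>
  (\<open>saddle_first_order\<close>), and these inequalities, being affine in the function and its gradient,
  survive integration (\<open>saddle_first_order_integral\<close>). They yield the strong monotonicity of
  \<open>G z\<close>, and they show that any solution of the variational inequality is the only minimax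
  solution and the only maximin solution (\<open>minimax_solution_of_VI\<close>,
  \<open>maximin_solution_of_VI\<close>). That the variational inequality has a solution follows from
  Brouwer's theorem (\<open>solves_VI_exists\<close>), since \<open>G z\<close> inherits the Lipschitz continuity of the
  saddle gradient.\<close>

section \<open>Gradients and strong convexity\<close>

lemma GDERIV_unique:
  fixes f :: "'a::real_inner \<Rightarrow> real"
  assumes "GDERIV f x :> D" and "GDERIV f x :> D'"
  shows "D = D'"
proof -
  have "(\<lambda>h. h \<bullet> D) = (\<lambda>h. h \<bullet> D')"
    using assms unfolding gderiv_def by (rule has_derivative_unique)
  then have "h \<bullet> D = h \<bullet> D'" for h
    by (rule fun_cong)
  then show ?thesis
    using vector_eq_ldot[of D D'] by blast
qed

lemma GDERIV_grad:
  fixes f :: "'a::euclidean_space \<Rightarrow> real"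
  assumes "f differentiable (at x)"
  shows "GDERIV f x :> grad f x"
proof -
  obtain f' where f': "(f has_derivative f') (at x)"
    using assms by (auto simp: differentiable_def)
  then have lin: "linear f'"
    by (rule has_derivative_linear)
  have "f' = (\<lambda>h. h \<bullet> adjoint f' 1)"
    using adjoint_works[OF lin, of _ 1] by (intro ext) simp
  then have g: "GDERIV f x :> adjoint f' 1"
    using f' unfolding gderiv_def by metis
  then show ?thesis
    unfolding grad_def by (rule theI) (rule GDERIV_unique[OF _ g])
qed

text \<open>Divide the strong convexity inequality on the segment from \<open>x\<close> to \<open>y\<close> by the parameter
  \<open>t\<close> and let \<open>t\<close> tend to \<open>0\<close> from the right.\<close>

lemma strongly_convex_on_first_order:
  fixes f :: "'a::euclidean_space \<Rightarrow> real"
  assumes sc: "strongly_convex_on \<gamma> S f" and "f differentiable (at x)"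
    and xy: "x \<in> S" "y \<in> S"
  shows "f x + grad f x \<bullet> (y - x) + \<gamma> / 2 * (norm (y - x))\<^sup>2 \<le> f y"
proof -
  define v where "v = y - x"
  have d: "(f has_derivative (\<lambda>h. h \<bullet> grad f x)) (at (x + 0 *\<^sub>R v))"
    using GDERIV_grad[OF assms(2)] by (simp add: gderiv_def)
  have "((\<lambda>t. x + t *\<^sub>R v) has_derivative (\<lambda>t. t *\<^sub>R v)) (at 0)"
    by (auto intro!: derivative_eq_intros)
  from has_derivative_compose[OF this d]
  have "((\<lambda>t. f (x + t *\<^sub>R v)) has_real_derivative grad f x \<bullet> v) (at 0)"
    by (simp add: has_field_derivative_def inner_commute mult_commute_abs)
  then have "((\<lambda>t. (f (x + t *\<^sub>R v) - f x) / t) \<longlongrightarrow> grad f x \<bullet> v) (at 0)"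
    by (simp add: has_field_derivative_iff)
  then have lim: "((\<lambda>t. (f (x + t *\<^sub>R v) - f x) / t) \<longlongrightarrow> grad f x \<bullet> v) (at_right 0)"
    by (rule filterlim_at_split[THEN iffD1, THEN conjunct2])
  have "((\<lambda>t. f y - f x - \<gamma> / 2 * (1 - t) * (norm v)\<^sup>2) \<longlongrightarrow>
      f y - f x - \<gamma> / 2 * (1 - 0) * (norm v)\<^sup>2) (at_right 0)"
    by (intro tendsto_intros)
  moreover have "\<forall>\<^sub>F t in at_right 0.
      (f (x + t *\<^sub>R v) - f x) / t \<le> f y - f x - \<gamma> / 2 * (1 - t) * (norm v)\<^sup>2"
    using eventually_at_right_real[OF zero_less_one]
  proof eventually_elim
    case (elim t)
    then have "f ((1 - t) *\<^sub>R x + t *\<^sub>R y)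
        \<le> (1 - t) * f x + t * f y - \<gamma> / 2 * t * (1 - t) * (norm (x - y))\<^sup>2"
      using sc xy by (auto simp: strongly_convex_on_def)
    moreover have "(1 - t) *\<^sub>R x + t *\<^sub>R y = x + t *\<^sub>R v"
      by (simp add: v_def algebra_simps)
    moreover have "norm (x - y) = norm v"
      by (simp add: v_def norm_minus_commute)
    ultimately have "f (x + t *\<^sub>R v) - f x \<le>
        t * (f y - f x - \<gamma> / 2 * (1 - t) * (norm v)\<^sup>2)"
      by (simp add: algebra_simps)
    then show ?case
      using elim by (simp add: pos_divide_le_eq mult.commute)
  qed
  ultimately have "grad f x \<bullet> v \<le> f y - f x - \<gamma> / 2 * (1 - 0) * (norm v)\<^sup>2"
    using lim by (intro tendsto_le[OF trivial_limit_at_right_real])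
  then show ?thesis
    by (simp add: v_def)
qed

section \<open>Strongly convex-concave functions and their variational inequality\<close>

text \<open>The operator \<open>G\<close> stands for \<open>(\<nabla>\<^sub>x F, - \<nabla>\<^sub>y F)\<close>, but the definition keeps only the two
  inequalities that strong convexity in \<open>x\<close> and strong concavity in \<open>y\<close> imply for it. So it makes
  sense for a function that is known on \<open>X \<times> Y\<close> only, even if these sets have empty interior,
  and it is stable under averaging.\<close>

definition saddle_first_order ::
    "real \<Rightarrow> 'a::real_inner set \<Rightarrow> 'b::real_inner set \<Rightarrow> ('a \<Rightarrow> 'b \<Rightarrow> real)
       \<Rightarrow> ('a \<times> 'b \<Rightarrow> 'a \<times> 'b) \<Rightarrow> bool" where
  "saddle_first_order \<gamma> X Y F G \<longleftrightarrow>
     (\<forall>x\<in>X. \<forall>y\<in>Y. \<forall>x'\<in>X. \<forall>y'\<in>Y.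
        F x y + fst (G (x, y)) \<bullet> (x' - x) + \<gamma> / 2 * (norm (x' - x))\<^sup>2 \<le> F x' y \<and>
        F x y' \<le> F x y - snd (G (x, y)) \<bullet> (y' - y) - \<gamma> / 2 * (norm (y' - y))\<^sup>2)"

lemma saddle_first_orderD:
  assumes "saddle_first_order \<gamma> X Y F G" "x \<in> X" "y \<in> Y"
  shows "x' \<in> X \<Longrightarrow>
      F x y + fst (G (x, y)) \<bullet> (x' - x) + \<gamma> / 2 * (norm (x' - x))\<^sup>2 \<le> F x' y"
    and "y' \<in> Y \<Longrightarrow>
      F x y' \<le> F x y - snd (G (x, y)) \<bullet> (y' - y) - \<gamma> / 2 * (norm (y' - y))\<^sup>2"
  using assms unfolding saddle_first_order_def by blast+

lemma saddle_first_order_saddle_grad: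
  fixes \<phi> :: "'a::euclidean_space \<Rightarrow> 'b::euclidean_space \<Rightarrow> 'w \<Rightarrow> real"
  assumes C1: "continuously_differentiable (\<lambda>(x, y). \<phi> x y w)"
    and sconvex: "\<And>y. strongly_convex_on \<gamma> UNIV (\<lambda>x. \<phi> x y w)"
    and sconcave: "\<And>x. strongly_concave_on \<gamma> UNIV (\<lambda>y. \<phi> x y w)"
  shows "saddle_first_order \<gamma> UNIV UNIV (\<lambda>x y. \<phi> x y w) (\<lambda>z. saddle_grad \<phi> z w)"
proof -
  have total: "(\<lambda>(x, y). \<phi> x y w) differentiable (at z)" for z
    using C1 unfolding continuously_differentiable_def differentiable_def by blast
  have dx: "(\<lambda>x. \<phi> x y w) differentiable (at x)" for x y
  proof -
    have "(\<lambda>x. (x, y)) differentiable (at x)"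
      by (intro derivative_intros)
    from differentiable_compose[OF total this] show ?thesis
      by simp
  qed
  have dy: "(\<lambda>y. \<phi> x y w) differentiable (at y)" for x y
  proof -
    have "(\<lambda>y. (x, y)) differentiable (at y)"
      by (intro derivative_intros)
    from differentiable_compose[OF total this] show ?thesis
      by simp
  qed
  have grad_minus: "grad (\<lambda>y. - \<phi> x y w) y = - grad (\<lambda>y. \<phi> x y w) y" for x y
  proof -
    have "GDERIV (\<lambda>y. - \<phi> x y w) y :> - grad (\<lambda>y. \<phi> x y w) y"
      using GDERIV_grad[OF dy] by (rule GDERIV_minus)
    moreover have "GDERIV (\<lambda>y. - \<phi> x y w) y :> grad (\<lambda>y. - \<phi> x y w) y"
      using dy by (intro GDERIV_grad differentiable_minus)
    ultimately show ?thesis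
      using GDERIV_unique by blast
  qed
  have "\<phi> x y w + grad (\<lambda>x. \<phi> x y w) x \<bullet> (x' - x) + \<gamma> / 2 * (norm (x' - x))\<^sup>2 \<le> \<phi> x' y w"
    for x x' y
    using strongly_convex_on_first_order[OF sconvex dx] by simp
  moreover have "- \<phi> x y w + - grad (\<lambda>y. \<phi> x y w) y \<bullet> (y' - y)
      + \<gamma> / 2 * (norm (y' - y))\<^sup>2 \<le> - \<phi> x y' w" for x y y'
    using strongly_convex_on_first_order[OF sconcave[unfolded strongly_concave_on_def]
        differentiable_minus[OF dy]] by (simp add: grad_minus)
  ultimately show ?thesis
    unfolding saddle_first_order_def saddle_grad_def by (fastforce simp: algebra_simps)
qed

text \<open>Write the four inequalities that lead from \<open>u = (x, y)\<close> and from \<open>v = (x', y')\<close> to the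
  mixed points \<open>(x', y)\<close> and \<open>(x, y')\<close>. In their sum all values of \<open>F\<close> cancel.\<close>

lemma saddle_first_order_strongly_monotone:
  assumes G: "saddle_first_order \<gamma> X Y F G" and uv: "u \<in> X \<times> Y" "v \<in> X \<times> Y"
  shows "\<gamma> * (norm (u - v))\<^sup>2 \<le> (G u - G v) \<bullet> (u - v)"
proof -
  obtain x y x' y' where eq: "u = (x, y)" "v = (x', y')"
    by (cases u, cases v)
  have mem: "x \<in> X" "y \<in> Y" "x' \<in> X" "y' \<in> Y"
    using uv eq by auto
  have flip: "norm (x' - x) = norm (x - x')" "norm (y' - y) = norm (y - y')"
    by (simp_all add: norm_minus_commute)
  have "(norm (u - v))\<^sup>2 = (norm (x - x'))\<^sup>2 + (norm (y - y'))\<^sup>2"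
    by (simp add: eq norm_Pair)
  then have split: "\<gamma> * (norm (u - v))\<^sup>2 = \<gamma> * (norm (x - x'))\<^sup>2 + \<gamma> * (norm (y - y'))\<^sup>2"
    by (simp add: algebra_simps)
  have "(G u - G v) \<bullet> (u - v) =
      - (fst (G u) \<bullet> (x' - x)) - fst (G v) \<bullet> (x - x')
      - snd (G u) \<bullet> (y' - y) - snd (G v) \<bullet> (y - y')"
    by (simp add: eq inner_prod_def inner_diff_left inner_diff_right)
  moreover have "F x y + fst (G u) \<bullet> (x' - x) + \<gamma> / 2 * (norm (x - x'))\<^sup>2 \<le> F x' y"
    "F x' y' + fst (G v) \<bullet> (x - x') + \<gamma> / 2 * (norm (x - x'))\<^sup>2 \<le> F x y'"
    "F x y' \<le> F x y - snd (G u) \<bullet> (y' - y) - \<gamma> / 2 * (norm (y - y'))\<^sup>2"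
    "F x' y \<le> F x' y' - snd (G v) \<bullet> (y - y') - \<gamma> / 2 * (norm (y - y'))\<^sup>2"
    using saddle_first_orderD(1)[OF G mem(1,2,3)] saddle_first_orderD(1)[OF G mem(3,4,1)]
      saddle_first_orderD(2)[OF G mem(1,2,4)] saddle_first_orderD(2)[OF G mem(3,4,2)]
    by (simp_all add: eq flip)
  ultimately show ?thesis
    unfolding split by linarith
qed

definition solves_VI :: "('a::real_inner \<Rightarrow> 'a) \<Rightarrow> 'a set \<Rightarrow> 'a \<Rightarrow> bool" where
  "solves_VI G Z h \<longleftrightarrow> h \<in> Z \<and> (\<forall>u\<in>Z. 0 \<le> G h \<bullet> (u - h))"

text \<open>A point \<open>h\<close> solves the variational inequality if it is the projection of \<open>h - G h\<close> to \<open>Z\<close>, by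
  the obtuse angle property of projections; Brouwer's theorem provides such a point.\<close>

lemma solves_VI_exists:
  fixes G :: "'a::euclidean_space \<Rightarrow> 'a"
  assumes Z: "compact Z" "convex Z" "Z \<noteq> {}" and G: "continuous_on Z G"
  shows "\<exists>h. solves_VI G Z h"
proof -
  have closed: "closed Z"
    using Z by (simp add: compact_imp_closed)
  have "continuous_on Z (closest_point Z \<circ> (\<lambda>u. u - G u))"
    using Z closed G
    by (intro continuous_on_compose continuous_intros continuous_on_closest_point)
  moreover have "closest_point Z \<circ> (\<lambda>u. u - G u) \<in> Z \<rightarrow> Z"
    using closest_point_in_set[OF closed Z(3)] by auto
  ultimately obtain h where h: "h \<in> Z" "closest_point Z (h - G h) = h"
    by (rule brouwer[OF Z]) auto
  have "0 \<le> G h \<bullet> (u - h)" if "u \<in> Z" for u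
    using closest_point_dot[OF Z(2) closed that, of "h - G h"] h(2) by simp
  then show ?thesis
    using h(1) by (auto simp: solves_VI_def)
qed

text \<open>Test each of the two variational inequalities with the solution of the other. They give
  \<open>(G h - G h') \<bullet> (h - h') \<le> (G' h' - G h') \<bullet> (h - h')\<close>, where the left side is at least
  \<open>\<gamma> \<parallel>h - h'\<parallel>\<^sup>2\<close> by monotonicity and the right side is estimated by Cauchy-Schwarz.\<close>

lemma solves_VI_stable:
  assumes mono: "\<gamma> * (norm (h - h'))\<^sup>2 \<le> (G h - G h') \<bullet> (h - h')" and "\<gamma> > 0"
    and VI: "solves_VI G Z h" "solves_VI G' Z h'"
  shows "norm (h - h') \<le> norm (G h' - G' h') / \<gamma>"
proof -
  have "G h \<bullet> (h - h') \<le> 0" and "0 \<le> G' h' \<bullet> (h - h')"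
    using VI unfolding solves_VI_def by (auto simp: inner_diff_right)
  then have "(G h - G h') \<bullet> (h - h') \<le> (G' h' - G h') \<bullet> (h - h')"
    by (simp add: inner_diff_left)
  also have "\<dots> \<le> norm (G h' - G' h') * norm (h - h')"
    using norm_cauchy_schwarz by (metis norm_minus_commute)
  finally have "\<gamma> * norm (h - h') * norm (h - h') \<le> norm (G h' - G' h') * norm (h - h')"
    using mono by (simp add: power2_eq_square)
  then have "\<gamma> * norm (h - h') \<le> norm (G h' - G' h')"
    by (cases "h = h'") (auto simp: mult_le_cancel_right)
  then show ?thesis
    using \<open>\<gamma> > 0\<close> by (simp add: pos_le_divide_eq mult.commute)
qed

text \<open>A solution \<open>(a, b)\<close> of the variational inequality is a saddle point of \<open>F\<close>: the gradient
  terms in the first-order inequalities at \<open>(a, b)\<close> have the right sign. Hence the inner supremum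
  at \<open>a\<close> is \<open>F a b\<close>, and the one at any \<open>x\<close> is at least \<open>F x b \<ge> F a b + \<gamma> / 2 \<parallel>x - a\<parallel>\<^sup>2\<close>.
  The quadratic term makes the minimizer unique.\<close>

lemma minimax_solution_of_VI:
  assumes G: "saddle_first_order \<gamma> X Y F G" and "\<gamma> > 0"
    and bd: "bounded Y" and VI: "solves_VI G (X \<times> Y) (a, b)"
  shows "is_arg_min (\<lambda>x. SUP y\<in>Y. F x y) (\<lambda>x. x \<in> X) x \<longleftrightarrow> x = a"
proof -
  have ab: "a \<in> X" "b \<in> Y"
    using VI by (auto simp: solves_VI_def)
  have "0 \<le> G (a, b) \<bullet> ((x, b) - (a, b))" if "x \<in> X" for x
    using VI ab that unfolding solves_VI_def by blast
  then have Gx: "0 \<le> fst (G (a, b)) \<bullet> (x - a)" if "x \<in> X" for x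
    using that by (simp add: inner_prod_def)
  have "0 \<le> G (a, b) \<bullet> ((a, y) - (a, b))" if "y \<in> Y" for y
    using VI ab that unfolding solves_VI_def by blast
  then have Gy: "0 \<le> snd (G (a, b)) \<bullet> (y - b)" if "y \<in> Y" for y
    using that by (simp add: inner_prod_def)
  have right: "F a y \<le> F a b" if "y \<in> Y" for y
  proof -
    have "0 \<le> \<gamma> / 2 * (norm (y - b))\<^sup>2"
      using \<open>\<gamma> > 0\<close> by simp
    then show ?thesis
      using saddle_first_orderD(2)[OF G ab that] Gy[OF that] by linarith
  qed
  have left: "F a b + \<gamma> / 2 * (norm (x - a))\<^sup>2 \<le> F x b" if "x \<in> X" for x
    using saddle_first_orderD(1)[OF G ab that] Gx[OF that] by linarith
  \<comment> \<open>The supremum of an unbounded set of reals would be an arbitrary value. The bound comes from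
    the affine majorant of the concave function \<open>F x\<close> at \<open>b\<close>.\<close>
  have bdd: "bdd_above (F x ` Y)" if x: "x \<in> X" for x
  proof -
    obtain B where B: "\<And>y. y \<in> Y \<Longrightarrow> norm (y - b) \<le> B"
      using bd ab(2) by (metis bounded_any_center dist_norm norm_minus_commute)
    have "F x y \<le> F x b + norm (snd (G (x, b))) * B" if "y \<in> Y" for y
    proof -
      have "- (snd (G (x, b)) \<bullet> (y - b)) \<le> norm (snd (G (x, b))) * norm (y - b)"
        using Cauchy_Schwarz_ineq2 by (metis abs_le_iff)
      also have "\<dots> \<le> norm (snd (G (x, b))) * B"
        using B[OF that] by (intro mult_left_mono) auto
      finally have "- (snd (G (x, b)) \<bullet> (y - b)) \<le> norm (snd (G (x, b))) * B" .
      moreover have "0 \<le> \<gamma> / 2 * (norm (y - b))\<^sup>2"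
        using \<open>\<gamma> > 0\<close> by simp
      ultimately show ?thesis
        using saddle_first_orderD(2)[OF G x ab(2) that] by linarith
    qed
    then show ?thesis
      by (intro bdd_aboveI2)
  qed
  have val: "(SUP y\<in>Y. F a y) = F a b"
    using ab right by (intro cSup_eq_maximum) auto
  have growth: "(SUP y\<in>Y. F a y) + \<gamma> / 2 * (norm (x - a))\<^sup>2 \<le> (SUP y\<in>Y. F x y)"
    if "x \<in> X" for x
    using left[OF that] cSUP_upper[OF ab(2) bdd[OF that]] val by linarith
  have ge: "(SUP y\<in>Y. F a y) \<le> (SUP y\<in>Y. F x y)" if "x \<in> X" for x
    using growth[OF that] \<open>\<gamma> > 0\<close> by (smt (verit) divide_nonneg_pos mult_nonneg_nonneg zero_le_power2)
  have "x = a" if "x \<in> X" "(SUP y\<in>Y. F x y) \<le> (SUP y\<in>Y. F a y)" for x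
  proof -
    have "\<gamma> / 2 * (norm (x - a))\<^sup>2 \<le> 0"
      using growth[OF that(1)] that(2) by linarith
    then show ?thesis
      using \<open>\<gamma> > 0\<close> by (simp add: mult_le_0_iff)
  qed
  then show ?thesis
    using ab(1) ge by (auto simp: is_arg_min_def not_less)
qed

text \<open>Exchanging the players and negating \<open>F\<close> turns minimax into maximin. The signs in \<open>G\<close> are such
  that its two components are merely exchanged.\<close>

lemma saddle_first_order_swap:
  assumes "saddle_first_order \<gamma> X Y F G"
  shows "saddle_first_order \<gamma> Y X (\<lambda>y x. - F x y) (prod.swap \<circ> G \<circ> prod.swap)"
  using assms unfolding saddle_first_order_def by (fastforce simp: algebra_simps)

lemma solves_VI_swap:
  assumes "solves_VI G (X \<times> Y) (a, b)"
  shows "solves_VI (prod.swap \<circ> G \<circ> prod.swap) (Y \<times> X) (b, a)"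
  using assms unfolding solves_VI_def by (simp add: inner_prod_def) (metis add.commute)

lemma maximin_solution_of_VI:
  assumes G: "saddle_first_order \<gamma> X Y F G" and "\<gamma> > 0"
    and bd: "bounded X" and VI: "solves_VI G (X \<times> Y) (a, b)"
  shows "is_arg_max (\<lambda>y. INF x\<in>X. F x y) (\<lambda>y. y \<in> Y) y \<longleftrightarrow> y = b"
proof -
  have "(INF x\<in>X. F x y) = - (SUP x\<in>X. - F x y)" for y
    by (simp add: Inf_real_def image_image)
  then have "is_arg_max (\<lambda>y. INF x\<in>X. F x y) (\<lambda>y. y \<in> Y) y \<longleftrightarrow>
      is_arg_min (\<lambda>y. SUP x\<in>X. - F x y) (\<lambda>y. y \<in> Y) y"
    by (simp add: is_arg_max_def is_arg_min_def)
  then show ?thesis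
    using minimax_solution_of_VI[OF saddle_first_order_swap[OF G] \<open>\<gamma> > 0\<close> bd solves_VI_swap[OF VI]]
    by simp
qed

section \<open>Expectations\<close>

lemma integrable_lipschitz:
  fixes f :: "'w::polish_space \<Rightarrow> 'c::euclidean_space"
  assumes \<mu>: "\<mu> \<in> prob_measures1" and lip: "\<And>w w'. norm (f w - f w') \<le> L * dist w w'"
  shows "integrable \<mu> f"
proof -
  from \<mu> obtain w0 where ps: "prob_space \<mu>" and sets: "sets \<mu> = sets borel"
    and w0: "integrable \<mu> (\<lambda>w. dist w0 w)"
    by (auto simp: prob_measures1_def)
  interpret prob_space \<mu> by (rule ps)
  have "norm (f w - f w') \<le> \<bar>L\<bar> * dist w w'" for w w'
    using lip[of w w'] mult_right_mono[OF abs_ge_self, of "dist w w'" L] by simp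
  then have "\<bar>L\<bar>-lipschitz_on UNIV f"
    by (auto simp: lipschitz_on_def dist_norm)
  then have "continuous_on UNIV f"
    by (rule lipschitz_on_continuous_on)
  then have meas: "f \<in> borel_measurable \<mu>"
    using borel_measurable_continuous_onI measurable_cong_sets[OF sets refl] by blast
  have int: "integrable \<mu> (\<lambda>w. norm (f w0) + L * dist w0 w)"
    using w0 by simp
  have "norm (f w) \<le> norm (norm (f w0) + L * dist w0 w)" for w
    using lip[of w w0] norm_triangle_sub[of "f w" "f w0"] by (simp add: dist_commute)
  then show ?thesis
    by (intro Bochner_Integration.integrable_bound[OF int meas] AE_I2)
qed

text \<open>The easy half of Kantorovich duality: for every coupling the difference of the two integrals
  is the integral of \<open>f (fst p) - f (snd p)\<close>, which is bounded by \<open>L\<close> times the transport cost.\<close>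

lemma integral_diff_le_wasserstein1:
  fixes f :: "'w::polish_space \<Rightarrow> 'c::euclidean_space"
  assumes \<mu>: "\<mu> \<in> prob_measures1" and \<nu>: "\<nu> \<in> prob_measures1"
    and lip: "\<And>w w'. norm (f w - f w') \<le> L * dist w w'" and "L \<ge> 0"
    and W: "wasserstein1 \<mu> \<nu> \<le> ennreal r" and "r \<ge> 0"
  shows "norm ((\<integral>w. f w \<partial>\<mu>) - (\<integral>w. f w \<partial>\<nu>)) \<le> L * r"
proof -
  have "L-lipschitz_on UNIV f"
    using lip \<open>L \<ge> 0\<close> by (auto simp: lipschitz_on_def dist_norm)
  then have meas: "f \<in> borel_measurable borel"
    by (intro borel_measurable_continuous_onI lipschitz_on_continuous_on)
  have bound: "ennreal (norm ((\<integral>w. f w \<partial>\<mu>) - (\<integral>w. f w \<partial>\<nu>)))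
      \<le> ennreal L * (\<integral>\<^sup>+ p. ennreal (dist (fst p) (snd p)) \<partial>\<pi>)"
    if \<pi>: "\<pi> \<in> couplings \<mu> \<nu>" for \<pi>
  proof -
    from \<pi> have sets: "sets \<pi> = sets borel"
      and d: "distr \<pi> borel fst = \<mu>" "distr \<pi> borel snd = \<nu>"
      by (auto simp: couplings_def)
    have m: "fst \<in> measurable \<pi> borel" "snd \<in> measurable \<pi> borel"
      unfolding measurable_cong_sets[OF sets refl]
      by (intro borel_measurable_continuous_onI continuous_intros)+
    have i: "integrable \<pi> (\<lambda>p. f (fst p))" "integrable \<pi> (\<lambda>p. f (snd p))"
      using integrable_lipschitz[OF \<mu> lip] integrable_lipschitz[OF \<nu> lip]
      by (auto simp: d[symmetric] integrable_distr_eq[OF m(1) meas] integrable_distr_eq[OF m(2) meas])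
    have "(\<integral>w. f w \<partial>\<mu>) - (\<integral>w. f w \<partial>\<nu>) = (\<integral>p. f (fst p) \<partial>\<pi>) - (\<integral>p. f (snd p) \<partial>\<pi>)"
      by (simp add: d[symmetric] integral_distr[OF m(1) meas] integral_distr[OF m(2) meas])
    also have "\<dots> = (\<integral>p. f (fst p) - f (snd p) \<partial>\<pi>)"
      using i by simp
    finally have "ennreal (norm ((\<integral>w. f w \<partial>\<mu>) - (\<integral>w. f w \<partial>\<nu>)))
        \<le> (\<integral>\<^sup>+ p. norm (f (fst p) - f (snd p)) \<partial>\<pi>)"
      using i by (simp only:) (intro integral_norm_bound_ennreal; simp)
    also have "\<dots> \<le> (\<integral>\<^sup>+ p. ennreal L * ennreal (dist (fst p) (snd p)) \<partial>\<pi>)"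
      using lip \<open>L \<ge> 0\<close> by (intro nn_integral_mono) (simp add: ennreal_mult'[symmetric] ennreal_leI)
    also have "\<dots> = ennreal L * (\<integral>\<^sup>+ p. ennreal (dist (fst p) (snd p)) \<partial>\<pi>)"
      by (intro nn_integral_cmult, unfold measurable_cong_sets[OF sets refl])
        (intro measurable_compose[OF borel_measurable_continuous_onI measurable_ennreal]
          continuous_intros)
    finally show ?thesis .
  qed
  \<comment> \<open>Any \<open>r' > r\<close> exceeds the cost of some coupling; afterwards \<open>r'\<close> tends to \<open>r\<close>.\<close>
  have "norm ((\<integral>w. f w \<partial>\<mu>) - (\<integral>w. f w \<partial>\<nu>)) \<le> L * r'" if "r < r'" for r'
  proof -
    have "wasserstein1 \<mu> \<nu> < ennreal r'"
      using W that \<open>r \<ge> 0\<close> by (auto intro: le_less_trans simp: ennreal_less_iff)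
    then obtain \<pi> where \<pi>: "\<pi> \<in> couplings \<mu> \<nu>"
      and less: "(\<integral>\<^sup>+ p. ennreal (dist (fst p) (snd p)) \<partial>\<pi>) < ennreal r'"
      by (auto simp: wasserstein1_def INF_less_iff)
    have "ennreal (norm ((\<integral>w. f w \<partial>\<mu>) - (\<integral>w. f w \<partial>\<nu>))) \<le> ennreal L * ennreal r'"
      using bound[OF \<pi>] less by (meson less_imp_le mult_left_mono order_trans zero_le)
    also have "\<dots> = ennreal (L * r')"
      using \<open>L \<ge> 0\<close> by (simp add: ennreal_mult')
    finally show ?thesis
      using \<open>L \<ge> 0\<close> \<open>r \<ge> 0\<close> that by simp
  qed
  moreover have "((\<lambda>r'. L * r') \<longlongrightarrow> L * r) (at_right r)"
    by (intro tendsto_intros)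
  ultimately show ?thesis
    by (intro tendsto_lowerbound[OF _ _ trivial_limit_at_right_real])
      (auto simp: eventually_at_right_less elim!: eventually_mono[OF eventually_at_right_less])
qed

lemma saddle_first_order_integral:
  fixes G :: "'a::euclidean_space \<times> 'b::euclidean_space \<Rightarrow> 'w \<Rightarrow> 'a \<times> 'b"
  assumes "prob_space M"
    and fo: "\<And>w. saddle_first_order \<gamma> X Y (\<lambda>x y. F x y w) (\<lambda>z. G z w)"
    and F: "\<And>x y. x \<in> X \<Longrightarrow> y \<in> Y \<Longrightarrow> integrable M (F x y)"
    and G: "\<And>z. integrable M (G z)"
  shows "saddle_first_order \<gamma> X Y (\<lambda>x y. \<integral>w. F x y w \<partial>M) (\<lambda>z. \<integral>w. G z w \<partial>M)"
proof -
  interpret prob_space M by fact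
  have Gf: "integrable M (\<lambda>w. fst (G z w))" and Gs: "integrable M (\<lambda>w. snd (G z w))"
    and If: "fst (\<integral>w. G z w \<partial>M) = (\<integral>w. fst (G z w) \<partial>M)"
    and Is: "snd (\<integral>w. G z w \<partial>M) = (\<integral>w. snd (G z w) \<partial>M)" for z
    using G[of z] by (auto simp: integral_bounded_linear[OF bounded_linear_fst]
        integral_bounded_linear[OF bounded_linear_snd]
        intro: integrable_bounded_linear[OF bounded_linear_fst]
          integrable_bounded_linear[OF bounded_linear_snd])
  {
    fix x y x' y' assume mem: "x \<in> X" "y \<in> Y" "x' \<in> X" "y' \<in> Y"
    have "(\<integral>w. F x y w + fst (G (x, y) w) \<bullet> (x' - x) + \<gamma> / 2 * (norm (x' - x))\<^sup>2 \<partial>M)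
        \<le> (\<integral>w. F x' y w \<partial>M)"
      using mem F Gf saddle_first_orderD(1)[OF fo mem(1,2,3)] by (intro integral_mono) auto
    then have "(\<integral>w. F x y w \<partial>M) + fst (\<integral>w. G (x, y) w \<partial>M) \<bullet> (x' - x)
        + \<gamma> / 2 * (norm (x' - x))\<^sup>2 \<le> (\<integral>w. F x' y w \<partial>M)"
      using mem F Gf by (simp add: If prob_space)
    moreover have "(\<integral>w. F x y' w \<partial>M) \<le>
        (\<integral>w. F x y w - snd (G (x, y) w) \<bullet> (y' - y) - \<gamma> / 2 * (norm (y' - y))\<^sup>2 \<partial>M)"
      using mem F Gs saddle_first_orderD(2)[OF fo mem(1,2,4)] by (intro integral_mono) auto
    then have "(\<integral>w. F x y' w \<partial>M) \<le> (\<integral>w. F x y w \<partial>M)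
        - snd (\<integral>w. G (x, y) w \<partial>M) \<bullet> (y' - y) - \<gamma> / 2 * (norm (y' - y))\<^sup>2"
      using mem F Gs by (simp add: Is prob_space)
    ultimately have "(\<integral>w. F x y w \<partial>M) + fst (\<integral>w. G (x, y) w \<partial>M) \<bullet> (x' - x)
        + \<gamma> / 2 * (norm (x' - x))\<^sup>2 \<le> (\<integral>w. F x' y w \<partial>M) \<and>
       (\<integral>w. F x y' w \<partial>M) \<le> (\<integral>w. F x y w \<partial>M)
        - snd (\<integral>w. G (x, y) w \<partial>M) \<bullet> (y' - y) - \<gamma> / 2 * (norm (y' - y))\<^sup>2" ..
  }
  then show ?thesis
    unfolding saddle_first_order_def by blast
qed

section \<open>Stability of the solution map and the equilibrium point\<close>

theorem theorem2p6:
  fixes \<phi> :: "real ^ 'n \<Rightarrow> real ^ 'm \<Rightarrow> 'w::polish_space \<Rightarrow> real"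
    and D :: "(real ^ 'n) \<times> (real ^ 'm) \<Rightarrow> 'w measure"
    and X :: "(real ^ 'n) set" and Y :: "(real ^ 'm) set"
    and \<gamma> L \<epsilon> :: real
  assumes "\<gamma> > 0" and "L > 0" and "\<epsilon> \<ge> 0"
    and D_range: "\<And>z. D z \<in> prob_measures1"
    and C1: "\<And>w. continuously_differentiable (\<lambda>(x, y). \<phi> x y w)"
    and sconvex: "\<And>w y. strongly_convex_on \<gamma> UNIV (\<lambda>x. \<phi> x y w)"
    and sconcave: "\<And>w x. strongly_concave_on \<gamma> UNIV (\<lambda>y. \<phi> x y w)"
    and lip_z: "\<And>z z' w. norm (saddle_grad \<phi> z w - saddle_grad \<phi> z' w) \<le> L * norm (z - z')"
    and lip_w: "\<And>z w w'. norm (saddle_grad \<phi> z w - saddle_grad \<phi> z w') \<le> L * dist w w'"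
    and sensitivity: "\<And>z z'. wasserstein1 (D z) (D z') \<le> ennreal (\<epsilon> * norm (z - z'))"
    and "compact X" and "convex X" and "X \<noteq> {}"
    and "compact Y" and "convex Y" and "Y \<noteq> {}"
    and expectation: "\<And>x' y' z. x' \<in> X \<Longrightarrow> y' \<in> Y \<Longrightarrow> z \<in> X \<times> Y \<Longrightarrow> integrable (D z) (\<phi> x' y')"
  shows "(\<exists>H. (\<forall>z\<in>X \<times> Y. H z \<in> X \<times> Y \<and> solution_map X Y \<phi> D z = {H z}) \<and>
              (\<forall>z\<in>X \<times> Y. \<forall>z'\<in>X \<times> Y. norm (H z - H z') \<le> \<epsilon> * L / \<gamma> * norm (z - z'))) \<and>
         (\<epsilon> * L / \<gamma> < 1 \<longrightarrow> (\<exists>!z. equilibrium_point X Y \<phi> D z))"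
proof -
  define Z where "Z = X \<times> Y"
  have Z: "compact Z" "convex Z" "Z \<noteq> {}"
    using assms by (auto simp: Z_def compact_Times convex_Times)
  define G where "G z u = (\<integral>w. saddle_grad \<phi> u w \<partial>D z)" for z u
  have int: "integrable (D z) (saddle_grad \<phi> u)" for z u
    using D_range lip_w by (rule integrable_lipschitz)
  have ps: "prob_space (D z)" for z
    using D_range[of z] by (simp add: prob_measures1_def)
  have fo: "saddle_first_order \<gamma> X Y (\<lambda>x y. decoupled \<phi> D x y z) (G z)" if "z \<in> Z" for z
    unfolding decoupled_def G_def
  proof (rule saddle_first_order_integral[OF ps _ _ int])
    show "saddle_first_order \<gamma> X Y (\<lambda>x y. \<phi> x y w) (\<lambda>z. saddle_grad \<phi> z w)" for w
      using saddle_first_order_saddle_grad[where \<phi> = \<phi> and w = w, OF C1 sconvex sconcave]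
      unfolding saddle_first_order_def by blast
    show "integrable (D z) (\<phi> x y)" if "x \<in> X" "y \<in> Y" for x y
      using expectation that \<open>z \<in> Z\<close> by (simp add: Z_def)
  qed
  have "norm (G z u - G z v) \<le> L * norm (u - v)" for z u v
  proof -
    interpret prob_space "D z" by (rule ps)
    have "norm (G z u - G z v) = norm (\<integral>w. saddle_grad \<phi> u w - saddle_grad \<phi> v w \<partial>D z)"
      using int by (simp add: G_def)
    also have "\<dots> \<le> (\<integral>w. norm (saddle_grad \<phi> u w - saddle_grad \<phi> v w) \<partial>D z)"
      by (rule integral_norm_bound)
    also have "\<dots> \<le> (\<integral>w. L * norm (u - v) \<partial>D z)"
      using int lip_z by (intro integral_mono) auto
    finally show ?thesis
      by (simp add: prob_space)
  qed
  then have "L-lipschitz_on Z (G z)" for z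
    using \<open>L > 0\<close> by (auto simp: lipschitz_on_def dist_norm)
  then have "\<exists>h. solves_VI (G z) Z h" for z
    using Z by (intro solves_VI_exists lipschitz_on_continuous_on)
  then obtain H where VI: "\<And>z. solves_VI (G z) Z (H z)"
    by metis
  have HZ: "H z \<in> Z" for z
    using VI by (simp add: solves_VI_def)
  have sol: "solution_map X Y \<phi> D z = {H z}" if "z \<in> Z" for z
  proof -
    have "solves_VI (G z) (X \<times> Y) (fst (H z), snd (H z))"
      using VI[of z] by (simp add: Z_def)
    from minimax_solution_of_VI[OF fo[OF that] \<open>\<gamma> > 0\<close> _ this]
      maximin_solution_of_VI[OF fo[OF that] \<open>\<gamma> > 0\<close> _ this]
    have "solution_map X Y \<phi> D z = {fst (H z)} \<times> {snd (H z)}"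
      using \<open>compact X\<close> \<open>compact Y\<close> by (simp add: solution_map_def compact_imp_bounded)
    then show ?thesis
      by simp
  qed
  have lip: "norm (H z - H z') \<le> \<epsilon> * L / \<gamma> * norm (z - z')" if "z \<in> Z" for z z'
  proof -
    have "norm (H z - H z') \<le> norm (G z (H z') - G z' (H z')) / \<gamma>"
      using saddle_first_order_strongly_monotone[OF fo[OF that]] HZ
      by (intro solves_VI_stable[OF _ \<open>\<gamma> > 0\<close> VI VI]) (simp add: Z_def)
    also have "\<dots> \<le> L * (\<epsilon> * norm (z - z')) / \<gamma>"
      unfolding G_def using assms
      by (intro divide_right_mono integral_diff_le_wasserstein1) auto
    finally show ?thesis
      by (simp add: mult_ac)
  qed
  have "\<exists>!z. equilibrium_point X Y \<phi> D z" if "\<epsilon> * L / \<gamma> < 1"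
  proof -
    have "\<exists>!z\<in>Z. H z = z"
      using Z HZ lip that assms(1-3)
      by (intro Banach_fix[where c = "\<epsilon> * L / \<gamma>"]) (auto simp: compact_imp_complete dist_norm)
    moreover have "equilibrium_point X Y \<phi> D z \<longleftrightarrow> z \<in> Z \<and> H z = z" for z
      using sol by (auto simp: equilibrium_point_def Z_def)
    ultimately show ?thesis
      by simp
  qed
  then show ?thesis
    using HZ sol lip by (auto simp: Z_def intro!: exI[of _ H])
qed

end
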